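(* Let $X$ be a normed linear space, $m\ge 2$, let $\mathbf{\Omega}=\{\Omega_1,\ldots,\Omega_m\}$ be a collection of subsets of $X$, and let $\bar x\in\bigcap_{i=1}^m\Omega_i$. (i) $\mathbf{\Omega}$ is semiregular at $\bar x$ if and only if there exist positive numbers $\gamma$ and $\delta$ such that $$\gamma\, d\Big(\bar x,\bigcap_{i=1}^m(\Omega_i-x_i)\Big)\le \max_{1\le i\le m}\|x_i\|\quad\text{for all } x_i\in\delta\mathbb{B}\ (i=1,\ldots,m).$$ Moreover, $\theta[\mathbf{\Omega}](\bar x)$ is the exact upper bound of all numbers $\gamma$ for which this condition is satisfied (for some $\delta>0$). (ii) $\mathbf{\Omega}$ is subregular at $\bar x$ if and only if there exist positive numbers $\gamma$ and $\delta$ such that $$\gamma\, d\Big(x,\bigcap_{i=1}^m\Omega_i\Big)\le \max_{1\le i\le m} d(x,\Omega_i)\quad\text{for all } x\in B_\delta(\bar x).$$ Moreover, $\zeta[\mathbf{\Omega}](\bar x)$ is the exact upper bound of all numbers $\gamma$ for which this condition is satisfied (for some $\delta>0$). (iii) $\mathbf{\Omega}$ is uniformly regular at $\bar x$ if and only if there exist positive numbers $\gamma$ and $\delta$ such that $$\gamma\, d\Big(x,\bigcap_{i=1}^m(\Omega_i-x_i)\Big)\le \max_{1\le i\le m} d(x+x_i,\Omega_i)$$ for any $x\in B_\delta(\bar x)$ and $x_i\in\delta\mathbb{B}$ $(i=1,\ldots,m)$. Moreover, $\hat\theta[\mathbf{\Omega}](\bar x)$ is the exact upper bound of all numbers $\gamma$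 for which this condition is satisfied (for some $\delta>0$).
   Context: $\mathbb{B}$ is the closed unit ball of $X$, $B_\delta(x)$ the closed ball of radius $\delta$ centred at $x$, and $d(x,\Omega)=\inf_{\omega\in\Omega}\|x-\omega\|$ (with $d(x,\emptyset)=+\infty$). Exact upper bounds may be $+\infty$; the exact upper bound is understood to be $0$ if no positive number has the required property. Definitions. - $\mathbf{\Omega}$ is semiregular at $\bar x$ iff there exist $\alpha,\delta>0$ such that $\bigcap_{i=1}^m(\Omega_i-x_i)\cap B_\rho(\bar x)\ne\emptyset$ for all $\rho\in]0,\delta[$ and all $x_i\in X$ with $\max_{1\le i\le m}\|x_i\|\le\alpha\rho$. - $\mathbf{\Omega}$ is subregular at $\bar x$ iff there exist $\alpha,\delta>0$ such that $\bigcap_{i=1}^m(\Omega_i+(\alpha\rho)\mathbb{B})\cap B_\delta(\bar x)\subseteq\big(\bigcap_{i=1}^m\Omega_i\big)+\rho\mathbb{B}$ for all $\rho\in]0,\delta[$. - $\mathbf{\Omega}$ is uniformly regular at $\bar x$ iff there exist $\alpha,\delta>0$ such that $\bigcap_{i=1}^m(\Omega_i-\omega_i-x_i)\cap(\rho\mathbb{B})\ne\emptyset$ for all $\rho\in]0,\delta[$, $\omega_i\in\Omega_i\cap B_\delta(\bar x)$, and all $x_i\in X$ $(i=1,\ldots,m)$ with $\max_{1\le i\le m}\|x_i\|\le\alpha\rho$. Constants. For $\rho,\delta>0$ put $$\theta_\rho[\mathbf{\Omega}](\bar x):=\sup\Big\{r\ge0:\ \bigcap_{i=1}^m(\Omega_i-x_i)\cap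 B_\rho(\bar x)\ne\emptyset\ \text{ for all } x_1,\ldots,x_m\in r\mathbb{B}\Big\},$$ $$\zeta_{\rho,\delta}[\mathbf{\Omega}](\bar x):=\sup\Big\{r\ge0:\ \bigcap_{i=1}^m(\Omega_i+r\mathbb{B})\cap B_\delta(\bar x)\subseteq\bigcap_{i=1}^m\Omega_i+\rho\mathbb{B}\Big\},$$ and $$\theta[\mathbf{\Omega}](\bar x):=\liminf_{\rho\downarrow0}\frac{\theta_\rho[\mathbf{\Omega}](\bar x)}{\rho},\qquad \zeta[\mathbf{\Omega}](\bar x):=\lim_{\delta\downarrow0}\inf_{0<\rho<\delta}\frac{\zeta_{\rho,\delta}[\mathbf{\Omega}](\bar x)}{\rho},$$ $$\hat\theta[\mathbf{\Omega}](\bar x):=\liminf_{\omega_i\to\bar x,\ \omega_i\in\Omega_i\,(1\le i\le m),\ \rho\downarrow0}\frac{\theta_\rho[\Omega_1-\omega_1,\ldots,\Omega_m-\omega_m](0)}{\rho}.$$ *)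

theory Defs
  imports "HOL-Analysis.Analysis" "HOL-Library.Set_Algebras"
begin

text \<open>
  A collection of \<open>m\<close> sets is a family \<open>\<Omega> :: nat \<Rightarrow> 'a set\<close> of which only the members with index in
  \<open>{1..m}\<close> are used. For \<open>r \<ge> 0\<close> the scaled closed unit ball is \<open>cball 0 r\<close>, and
  \<open>A + cball 0 r\<close> is the Minkowski sum. Suprema are taken in \<open>ereal\<close>, as they may be infinite.
\<close>

abbreviation translate_back :: "'a::real_normed_vector set \<Rightarrow> 'a \<Rightarrow> 'a set" (infixl \<open>\<ominus>\<^sub>t\<close> 65)
  where "A \<ominus>\<^sub>t a \<equiv> (\<lambda>w. w - a) ` A"

text \<open>Unlike \<^const>\<open>infdist\<close>, this is \<open>\<infinity>\<close> for the empty set.\<close>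

definition edist_to :: "'a::real_normed_vector \<Rightarrow> 'a set \<Rightarrow> ereal"
  where "edist_to x A = (INF w\<in>A. ereal (norm (x - w)))"

definition semiregular :: "nat \<Rightarrow> (nat \<Rightarrow> 'a::real_normed_vector set) \<Rightarrow> 'a \<Rightarrow> bool"
  where "semiregular m \<Omega> xbar \<longleftrightarrow>
    (\<exists>\<alpha>>0. \<exists>\<delta>>0. \<forall>\<rho>\<in>{0<..<\<delta>}. \<forall>x :: nat \<Rightarrow> 'a.
       (MAX i\<in>{1..m}. norm (x i)) \<le> \<alpha> * \<rho> \<longrightarrow>
       (\<Inter>i\<in>{1..m}. \<Omega> i \<ominus>\<^sub>t x i) \<inter> cball xbar \<rho> \<noteq> {})"

definition subregular :: "nat \<Rightarrow> (nat \<Rightarrow> 'a::real_normed_vector set) \<Rightarrow> 'a \<Rightarrow> bool"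
  where "subregular m \<Omega> xbar \<longleftrightarrow>
    (\<exists>\<alpha>>0. \<exists>\<delta>>0. \<forall>\<rho>\<in>{0<..<\<delta>}.
       (\<Inter>i\<in>{1..m}. \<Omega> i + cball 0 (\<alpha> * \<rho>)) \<inter> cball xbar \<delta>
         \<subseteq> (\<Inter>i\<in>{1..m}. \<Omega> i) + cball 0 \<rho>)"

definition uniformly_regular :: "nat \<Rightarrow> (nat \<Rightarrow> 'a::real_normed_vector set) \<Rightarrow> 'a \<Rightarrow> bool"
  where "uniformly_regular m \<Omega> xbar \<longleftrightarrow>
    (\<exists>\<alpha>>0. \<exists>\<delta>>0. \<forall>\<rho>\<in>{0<..<\<delta>}. \<forall>(\<omega> :: nat \<Rightarrow> 'a) (x :: nat \<Rightarrow> 'a).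
       (\<forall>i\<in>{1..m}. \<omega> i \<in> \<Omega> i \<inter> cball xbar \<delta>) \<longrightarrow>
       (MAX i\<in>{1..m}. norm (x i)) \<le> \<alpha> * \<rho> \<longrightarrow>
       (\<Inter>i\<in>{1..m}. \<Omega> i \<ominus>\<^sub>t \<omega> i \<ominus>\<^sub>t x i) \<inter> cball 0 \<rho> \<noteq> {})"

definition theta_rho :: "nat \<Rightarrow> (nat \<Rightarrow> 'a::real_normed_vector set) \<Rightarrow> 'a \<Rightarrow> real \<Rightarrow> ereal"
  where "theta_rho m \<Omega> xbar \<rho> =
    (SUP r\<in>{r :: real. 0 \<le> r \<and>
        (\<forall>x :: nat \<Rightarrow> 'a. (\<forall>i\<in>{1..m}. x i \<in> cball 0 r) \<longrightarrow>
          (\<Inter>i\<in>{1..m}. \<Omega> i \<ominus>\<^sub>t x i) \<inter> cball xbar \<rho> \<noteq> {})}. ereal r)"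

definition zeta_rho_delta ::
    "nat \<Rightarrow> (nat \<Rightarrow> 'a::real_normed_vector set) \<Rightarrow> 'a \<Rightarrow> real \<Rightarrow> real \<Rightarrow> ereal"
  where "zeta_rho_delta m \<Omega> xbar \<rho> \<delta> =
    (SUP r\<in>{r :: real. 0 \<le> r \<and>
        (\<Inter>i\<in>{1..m}. \<Omega> i + cball 0 r) \<inter> cball xbar \<delta>
          \<subseteq> (\<Inter>i\<in>{1..m}. \<Omega> i) + cball 0 \<rho>}. ereal r)"

definition theta :: "nat \<Rightarrow> (nat \<Rightarrow> 'a::real_normed_vector set) \<Rightarrow> 'a \<Rightarrow> ereal"
  where "theta m \<Omega> xbar = Liminf (at_right 0) (\<lambda>\<rho>. theta_rho m \<Omega> xbar \<rho> / ereal \<rho>)"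

text \<open>The limit exists, see \<open>zeta_tendsto\<close> below.\<close>

definition zeta :: "nat \<Rightarrow> (nat \<Rightarrow> 'a::real_normed_vector set) \<Rightarrow> 'a \<Rightarrow> ereal"
  where "zeta m \<Omega> xbar =
    Lim (at_right 0) (\<lambda>\<delta>. INF \<rho>\<in>{0<..<\<delta>}. zeta_rho_delta m \<Omega> xbar \<rho> \<delta> / ereal \<rho>)"

text \<open>
  The filter \<open>\<omega>\<^sub>i \<rightarrow> xbar\<close>, \<open>\<omega>\<^sub>i \<in> \<Omega>\<^sub>i\<close> for \<open>1 \<le> i \<le> m\<close>; the value \<open>\<omega>\<^sub>i = xbar\<close> is not excluded, hence
  \<^const>\<open>nhds\<close> and not \<^const>\<open>at_within\<close>.
\<close>

definition points_to ::
    "nat \<Rightarrow> (nat \<Rightarrow> 'a::real_normed_vector set) \<Rightarrow> 'a \<Rightarrow> (nat \<Rightarrow> 'a) filter"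
  where "points_to m \<Omega> xbar =
    (INF i\<in>{1..m}. filtercomap (\<lambda>\<omega>. \<omega> i) (inf (nhds xbar) (principal (\<Omega> i))))"

definition theta_hat :: "nat \<Rightarrow> (nat \<Rightarrow> 'a::real_normed_vector set) \<Rightarrow> 'a \<Rightarrow> ereal"
  where "theta_hat m \<Omega> xbar =
    Liminf (points_to m \<Omega> xbar \<times>\<^sub>F at_right 0)
      (\<lambda>(\<omega>, \<rho>). theta_rho m (\<lambda>i. \<Omega> i \<ominus>\<^sub>t \<omega> i) 0 \<rho> / ereal \<rho>)"

text \<open>By convention \<open>0\<close> if no positive number has the property.\<close>

definition exact_upper_bound :: "(real \<Rightarrow> bool) \<Rightarrow> ereal"
  where "exact_upper_bound P =
    (if \<exists>\<gamma>>0. P \<gamma> then SUP \<gamma>\<in>{\<gamma>. 0 < \<gamma> \<and> P \<gamma>}. ereal \<gamma> else 0)"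

lemma zeta_tendsto:
  fixes \<Omega> :: "nat \<Rightarrow> 'a::real_normed_vector set"
  shows "((\<lambda>\<delta>. INF \<rho>\<in>{0<..<\<delta>}. zeta_rho_delta m \<Omega> xbar \<rho> \<delta> / ereal \<rho>) \<longlongrightarrow> zeta m \<Omega> xbar)
    (at_right 0)"
proof -
  define f where "f = (\<lambda>\<delta>. INF \<rho>\<in>{0<..<\<delta>}. zeta_rho_delta m \<Omega> xbar \<rho> \<delta> / ereal \<rho>)"
  have z_mono: "zeta_rho_delta m \<Omega> xbar \<rho> b \<le> zeta_rho_delta m \<Omega> xbar \<rho> a" if "a \<le> b" for a b \<rho>
  proof -
    have "cball xbar a \<subseteq> cball xbar b" using that by auto
    then show ?thesis
      unfolding zeta_rho_delta_def by (intro SUP_subset_mono) blast+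
  qed
  have mono: "f b \<le> f a" if "0 < a" "a \<le> b" for a b
    unfolding f_def
  proof (rule INF_mono)
    fix \<rho> assume \<rho>: "\<rho> \<in> {0<..<a}"
    then show "\<exists>\<rho>'\<in>{0<..<b}. zeta_rho_delta m \<Omega> xbar \<rho>' b / ereal \<rho>'
        \<le> zeta_rho_delta m \<Omega> xbar \<rho> a / ereal \<rho>"
      using that z_mono[OF that(2)] by (intro bexI[of _ \<rho>]) (auto intro!: ereal_divide_right_mono)
  qed
  have "(f \<longlongrightarrow> (SUP \<delta>\<in>{0<..}. f \<delta>)) (at_right 0)"
  proof (rule order_tendstoI)
    fix c assume "c < (SUP \<delta>\<in>{0<..}. f \<delta>)"
    then obtain d where d: "d > 0" "c < f d" by (auto simp: less_SUP_iff)
    then show "eventually (\<lambda>\<delta>. c < f \<delta>) (at_right 0)"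
      unfolding eventually_at_right_field
      using mono[of _ d] by (intro exI[of _ d]) (auto intro: less_le_trans[OF d(2)])
  next
    fix c assume c: "(SUP \<delta>\<in>{0<..}. f \<delta>) < c"
    have "f \<delta> < c" if "\<delta> > 0" for \<delta>
      using that c by (meson SUP_upper greaterThan_iff le_less_trans)
    then show "eventually (\<lambda>\<delta>. f \<delta> < c) (at_right 0)"
      by (auto simp: eventually_at_right_field intro: exI[of _ 1])
  qed
  then have "(f \<longlongrightarrow> Lim (at_right 0) f) (at_right 0)"
    using tendsto_Lim[of "at_right (0::real)" f] by simp
  then show ?thesis unfolding zeta_def f_def .
qed

end

theory Submission
  imports Defs
begin

text \<open>
  In each part the regularity property has the form \<open>\<exists>\<alpha> > 0. C \<alpha>\<close>, and the constant is, by
  unfolding its limit, the exact upper bound of all \<open>\<alpha>\<close> with \<open>C \<alpha>\<close>. The metric inequality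
  \<open>A \<gamma>\<close> is linked to \<open>C\<close> by \<open>C \<alpha> \<Longrightarrow> A \<alpha>\<close> (take \<open>\<rho>\<close> to be, or slightly exceed, the
  right-hand side of the inequality divided by \<open>\<alpha>\<close>) and by \<open>A \<gamma> \<Longrightarrow> C \<alpha>\<close> for all \<open>\<alpha> < \<gamma>\<close> (the
  distance is not attained in general, which is why \<open>\<alpha> = \<gamma>\<close> may fail).
\<close>

section \<open>Exact upper bounds and quotients of suprema\<close>

text \<open>\<open>TC\<close> and \<open>CT\<close> make a positive \<open>T\<close> the supremum of
  the positive numbers satisfying \<open>C\<close>. \<open>CA\<close> and \<open>AC\<close> place
  \<open>A\<close> and \<open>C\<close> within an arbitrarily small gap of each other, so both have
  the same supremum and are satisfiable together. \<open>nonneg\<close> matches the value 0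
  prescribed when no positive number satisfies \<open>A\<close>.\<close>

lemma eq_exact_upper_bound:
  assumes nonneg: "0 \<le> T"
    and CA: "\<And>c. 0 < c \<Longrightarrow> C c \<Longrightarrow> A c"
    and AC: "\<And>c d. 0 < c \<Longrightarrow> c < d \<Longrightarrow> A d \<Longrightarrow> C c"
    and TC: "\<And>c. 0 < c \<Longrightarrow> ereal c < T \<Longrightarrow> C c"
    and CT: "\<And>c. 0 < c \<Longrightarrow> C c \<Longrightarrow> ereal c \<le> T"
  shows "((\<exists>c>0. C c) \<longleftrightarrow> (\<exists>c>0. A c)) \<and> T = exact_upper_bound A"
proof
  show "(\<exists>c>0. C c) \<longleftrightarrow> (\<exists>c>0. A c)"
    using CA AC by (meson dense)
  have le: "ereal d \<le> T" if "0 < d" "A d" for d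
  \<comment> \<open>\<open>A d\<close> yields \<open>C w\<close> only for \<open>w\<close> strictly
    below \<open>d\<close>; density recovers \<open>d\<close> itself.\<close>
  proof (rule dense_le_bounded[of 0])
    fix w assume "0 < w" "w < ereal d"
    then show "w \<le> T"
      using AC[OF _ _ \<open>A d\<close>] CT by (cases w) auto
  qed (use that in auto)
  show "T = exact_upper_bound A"
  proof (cases "\<exists>c>0. A c")
    case True
    then obtain c0 where c0: "0 < c0" "A c0" by blast
    let ?S = "SUP \<gamma>\<in>{\<gamma>. 0 < \<gamma> \<and> A \<gamma>}. ereal \<gamma>"
    have upper: "ereal c \<le> ?S" if "0 < c" "A c" for c
      using that by (auto intro: SUP_upper)
    have "0 < ?S" using upper[OF c0] c0(1) by (meson ereal_less(2) less_le_trans)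
    have "T \<le> ?S"
    \<comment> \<open>Approximating \<open>T\<close> from below also covers
      \<open>T = \<infinity>\<close>, as each relevant \<open>w\<close> is real.\<close>
    proof (rule dense_le)
      fix w assume w: "w < T"
      show "w \<le> ?S"
      proof (cases "0 < w")
        case True
        then show ?thesis
          using w TC CA upper by (cases w) auto
      qed (use \<open>0 < ?S\<close> in \<open>simp add: not_less\<close>)
    qed
    moreover have "?S \<le> T" using le by (auto intro: SUP_least)
    ultimately show ?thesis using True by (simp add: exact_upper_bound_def)
  next
    case False
    have "T \<le> 0"
    proof (rule ccontr)
      assume "\<not> T \<le> 0"
      then obtain c where "ereal c < T" "0 < ereal c"
        using ereal_dense2[of 0 T] by (metis not_le)
      then show False using TC CA False by auto
    qed
    then show ?thesis using False nonneg by (auto simp: exact_upper_bound_def)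
  qed
qed

text \<open>The supremum need not be attained, so a strict inequality is required to find an
  admissible \<open>r\<close> above \<open>c * \<rho>\<close>; \<open>antimono\<close> then descends
  to \<open>c * \<rho>\<close>. Both \<open>theta_rho\<close> and \<open>zeta_rho_delta\<close>
  divided by \<open>\<rho>\<close> have this shape.\<close>

lemma less_SUP_ereal_divideD:
  assumes "ereal c < (SUP r\<in>{r::real. 0 \<le> r \<and> Q r}. ereal r) / ereal \<rho>" "0 < \<rho>"
    and antimono: "\<And>r s. r \<le> s \<Longrightarrow> Q s \<Longrightarrow> Q r"
  shows "Q (c * \<rho>)"
proof -
  have "ereal (c * \<rho>) < (SUP r\<in>{r. 0 \<le> r \<and> Q r}. ereal r)"
    using assms(1,2) by (simp add: ereal_less_divide_pos mult.commute)
  then obtain r where "Q r" "c * \<rho> < r" by (auto simp: less_SUP_iff)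
  then show ?thesis using antimono[of "c * \<rho>" r] by simp
qed

lemma le_SUP_ereal_divideI:
  assumes "Q (c * \<rho>)" "0 < \<rho>" "0 \<le> c"
  shows "ereal c \<le> (SUP r\<in>{r::real. 0 \<le> r \<and> Q r}. ereal r) / ereal \<rho>"
proof -
  have "ereal (c * \<rho>) \<le> (SUP r\<in>{r. 0 \<le> r \<and> Q r}. ereal r)"
    using assms by (auto intro: SUP_upper)
  then show ?thesis using assms by (simp add: ereal_le_divide_pos mult.commute)
qed

section \<open>Extended distance to a set\<close>

lemma edist_to_le: "w \<in> A \<Longrightarrow> edist_to x A \<le> ereal (norm (x - w))"
  unfolding edist_to_def by (rule INF_lower)

lemma edist_to_less_iff: "edist_to x A < ereal r \<longleftrightarrow> (\<exists>w\<in>A. norm (x - w) < r)"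
  by (simp add: edist_to_def INF_less_iff)

lemma edist_to_nonneg: "0 \<le> edist_to x A"
  unfolding edist_to_def by (rule INF_greatest) simp

text \<open>This is where the gap \<open>c < d\<close> pays off: the distance is at most
  \<open>(c / d) * r\<close>, hence strictly less than \<open>r\<close>, and a strict bound on an
  infimum is witnessed by a point.\<close>

lemma near_point_of_edist_le:
  assumes "ereal d * edist_to x A \<le> ereal (c * r)" "0 < c" "c < d" "0 < r"
  obtains w where "w \<in> A" "norm (x - w) < r"
proof -
  \<comment> \<open>Since \<open>d > 0\<close>, an infinite distance would make the left-hand side
    infinite; in particular \<open>A\<close> is nonempty.\<close>
  have "edist_to x A \<noteq> \<infinity>" "edist_to x A \<noteq> - \<infinity>"
    using assms edist_to_nonneg[of x A] by auto
  then obtain e where e: "edist_to x A = ereal e" by (cases "edist_to x A") auto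
  have "d * e \<le> c * r" using assms e by simp
  also have "\<dots> < d * r" using assms by simp
  finally have "e < r" using assms by simp
  then show thesis using e edist_to_less_iff[of x A r] that by auto
qed

text \<open>The slack \<open>t < s\<close> compensates for distances that are not attained.\<close>

lemma mult_edist_to_le:
  assumes "0 < c" "0 \<le> t" "t < ereal b"
    and "\<And>s. t < ereal s \<Longrightarrow> s < b \<Longrightarrow> \<exists>w\<in>A. norm (x - w) \<le> s / c"
  shows "ereal c * edist_to x A \<le> t"
\<comment> \<open>The cap \<open>b\<close> confines \<open>s\<close> to values close to
  \<open>t\<close>, because the regularity properties only supply points for small radii.\<close>
proof (rule dense_ge_bounded[OF assms(3)])
  fix u assume u: "t < u" "u < ereal b"
  then obtain s where s: "u = ereal s" using assms(2) by (cases u) auto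
  obtain w where w: "w \<in> A" "norm (x - w) \<le> s / c" using assms(4) u s by auto
  then have "edist_to x A \<le> ereal (s / c)"
    using edist_to_le by (meson ereal_less_eq(3) order_trans)
  then have "ereal c * edist_to x A \<le> ereal c * ereal (s / c)"
    using assms(1) by (intro ereal_mult_left_mono) auto
  then show "ereal c * edist_to x A \<le> u" using assms(1) s by simp
qed

section \<open>Membership in translates and Minkowski sums\<close>

lemma mem_translate_back_iff: "z \<in> A \<ominus>\<^sub>t a \<longleftrightarrow> z + a \<in> A"
  by (auto simp: image_iff eq_diff_eq)

lemma mem_plus_cball_iff: "z \<in> A + cball 0 r \<longleftrightarrow> (\<exists>w\<in>A. norm (z - w) \<le> r)"
  for A :: "'a::real_normed_vector set"
proof
  assume "\<exists>w\<in>A. norm (z - w) \<le> r"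
  then obtain w where "w \<in> A" "z - w \<in> cball 0 r" by auto
  then have "w + (z - w) \<in> A + cball 0 r" by (rule set_plus_intro)
  then show "z \<in> A + cball 0 r" by simp
qed (auto elim!: set_plus_elim intro!: bexI[rotated])

section \<open>Maxima over the nonempty index set\<close>

context
  fixes m :: nat
  assumes m: "1 \<le> m"
begin

text \<open>Polymorphic, since maxima are taken both of real norms and of \<open>ereal\<close>
  distances.\<close>

lemma MAX_le_iff: "(MAX i\<in>{1..m}. f i) \<le> c \<longleftrightarrow> (\<forall>i\<in>{1..m}. f i \<le> c)"
  for f :: "nat \<Rightarrow> 'b::linorder"
  using m by simp

lemma MAX_less_iff: "(MAX i\<in>{1..m}. f i) < c \<longleftrightarrow> (\<forall>i\<in>{1..m}. f i < c)"
  for f :: "nat \<Rightarrow> 'b::linorder"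
  using m by simp

lemma MAX_nonneg:
  fixes f :: "nat \<Rightarrow> 'b::{linorder,zero}"
  assumes "\<And>i. 0 \<le> f i"
  shows "0 \<le> (MAX i\<in>{1..m}. f i)"
proof -
  have "f 1 \<le> (MAX i\<in>{1..m}. f i)" using m by simp
  with assms[of 1] show ?thesis by (rule order_trans)
qed

section \<open>Translated sets meeting a ball, and semiregularity\<close>

text \<open>The common core of \<open>semiregular\<close> and \<open>theta_rho\<close>; applied to
  the sets translated by \<open>\<omega>\<close> and to the centre 0, it also expresses
  \<open>uniformly_regular\<close>.\<close>

definition shift_meets :: "(nat \<Rightarrow> 'a::real_normed_vector set) \<Rightarrow> 'a \<Rightarrow> real \<Rightarrow> real \<Rightarrow> bool"
  where "shift_meets \<Omega> xbar \<rho> r \<longleftrightarrow>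
    (\<forall>x :: nat \<Rightarrow> 'a. (\<forall>i\<in>{1..m}. norm (x i) \<le> r) \<longrightarrow>
       (\<Inter>i\<in>{1..m}. \<Omega> i \<ominus>\<^sub>t x i) \<inter> cball xbar \<rho> \<noteq> {})"

lemma shift_meets_antimono: "r \<le> s \<Longrightarrow> shift_meets \<Omega> xbar \<rho> s \<Longrightarrow> shift_meets \<Omega> xbar \<rho> r"
  unfolding shift_meets_def by (meson order_trans)

text \<open>Gives \<open>C 0\<close> in the regularity proofs, from which the constants are seen to
  be nonnegative.\<close>

lemma shift_meets_0:
  assumes "xbar \<in> (\<Inter>i\<in>{1..m}. \<Omega> i)" "0 < \<rho>"
  shows "shift_meets \<Omega> xbar \<rho> 0"
  unfolding shift_meets_def
proof (intro allI impI)
  fix x :: "nat \<Rightarrow> 'a" assume "\<forall>i\<in>{1..m}. norm (x i) \<le> 0"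
  then have "xbar \<in> (\<Inter>i\<in>{1..m}. \<Omega> i \<ominus>\<^sub>t x i) \<inter> cball xbar \<rho>"
    using assms by (auto simp: mem_translate_back_iff)
  then show "(\<Inter>i\<in>{1..m}. \<Omega> i \<ominus>\<^sub>t x i) \<inter> cball xbar \<rho> \<noteq> {}" by blast
qed

lemma theta_rho_eq:
  "theta_rho m \<Omega> xbar \<rho> = (SUP r\<in>{r. 0 \<le> r \<and> shift_meets \<Omega> xbar \<rho> r}. ereal r)"
  by (simp add: theta_rho_def shift_meets_def)

lemma less_theta_rho_divideD:
  "ereal c < theta_rho m \<Omega> xbar \<rho> / ereal \<rho> \<Longrightarrow> 0 < \<rho> \<Longrightarrow> shift_meets \<Omega> xbar \<rho> (c * \<rho>)"
  unfolding theta_rho_eq by (erule less_SUP_ereal_divideD) (auto intro: shift_meets_antimono)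

lemma le_theta_rho_divideI:
  "shift_meets \<Omega> xbar \<rho> (c * \<rho>) \<Longrightarrow> 0 < \<rho> \<Longrightarrow> 0 \<le> c \<Longrightarrow> ereal c \<le> theta_rho m \<Omega> xbar \<rho> / ereal \<rho>"
  unfolding theta_rho_eq by (rule le_SUP_ereal_divideI)

lemma semiregularity:
  fixes \<Omega> :: "nat \<Rightarrow> 'a::real_normed_vector set"
  assumes xbar: "xbar \<in> (\<Inter>i\<in>{1..m}. \<Omega> i)"
  defines "A \<equiv> \<lambda>\<gamma>. \<exists>\<delta>>0. \<forall>x :: nat \<Rightarrow> 'a. (\<forall>i\<in>{1..m}. x i \<in> cball 0 \<delta>) \<longrightarrow>
          ereal \<gamma> * edist_to xbar (\<Inter>i\<in>{1..m}. \<Omega> i \<ominus>\<^sub>t x i) \<le> ereal (MAX i\<in>{1..m}. norm (x i))"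
  shows "(semiregular m \<Omega> xbar \<longleftrightarrow> (\<exists>\<gamma>>0. A \<gamma>)) \<and> theta m \<Omega> xbar = exact_upper_bound A"
proof -
  define C where "C = (\<lambda>\<alpha>. \<exists>\<delta>>0. \<forall>\<rho>\<in>{0<..<\<delta>}. shift_meets \<Omega> xbar \<rho> (\<alpha> * \<rho>))"
  have reg: "semiregular m \<Omega> xbar \<longleftrightarrow> (\<exists>\<alpha>>0. C \<alpha>)"
    unfolding semiregular_def C_def shift_meets_def MAX_le_iff ..
  \<comment> \<open>As an eventual property, \<open>C\<close> can be compared directly with the
    \<open>Liminf\<close> in \<open>theta\<close>.\<close>
  have C_iff: "C \<alpha> \<longleftrightarrow> (\<forall>\<^sub>F \<rho> in at_right 0. shift_meets \<Omega> xbar \<rho> (\<alpha> * \<rho>))" for \<alpha>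
    unfolding C_def by (auto simp: eventually_at_right_field)
  have pos: "\<forall>\<^sub>F \<rho>::real in at_right 0. 0 < \<rho>" by (simp add: eventually_at_right_less)
  \<comment> \<open>The case \<open>c = 0\<close> is included in order to derive
    \<open>0 \<le> theta m \<Omega> xbar\<close> from \<open>C 0\<close>.\<close>
  have C_le: "ereal c \<le> theta m \<Omega> xbar" if "C c" "0 \<le> c" for c
    unfolding theta_def
    by (rule Liminf_bounded, use that(1)[unfolded C_iff] pos in eventually_elim)
      (rule le_theta_rho_divideI, use that in auto)
  show ?thesis
    unfolding reg
  proof (rule eq_exact_upper_bound)
    have "C 0" unfolding C_def using shift_meets_0[OF xbar] by (auto intro: exI[of _ 1])
    then show "0 \<le> theta m \<Omega> xbar" using C_le[of 0] by (simp add: zero_ereal_def)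
  next
    fix c :: real assume "0 < c" "C c" then show "ereal c \<le> theta m \<Omega> xbar" by (simp add: C_le)
  next
    fix c :: real assume "ereal c < theta m \<Omega> xbar"
    then have "\<forall>\<^sub>F \<rho> in at_right 0. ereal c < theta_rho m \<Omega> xbar \<rho> / ereal \<rho>"
      unfolding theta_def by (rule less_LiminfD)
    then show "C c"
      unfolding C_iff using pos by eventually_elim (rule less_theta_rho_divideD)
  next
    fix c :: real assume c: "0 < c" and "C c"
    then obtain \<delta> where \<delta>: "0 < \<delta>" "\<And>\<rho>. 0 < \<rho> \<Longrightarrow> \<rho> < \<delta> \<Longrightarrow> shift_meets \<Omega> xbar \<rho> (c * \<rho>)"
      by (auto simp: C_def)
    have "ereal c * edist_to xbar (\<Inter>i\<in>{1..m}. \<Omega> i \<ominus>\<^sub>t x i) \<le> ereal (MAX i\<in>{1..m}. norm (x i))"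
      \<comment> \<open>The half keeps the largest shift strictly below \<open>c * \<delta>\<close>,
        leaving room for \<open>s\<close>.\<close>
      if x: "\<forall>i\<in>{1..m}. x i \<in> cball 0 (c * \<delta> / 2)" for x :: "nat \<Rightarrow> 'a"
    proof (rule mult_edist_to_le[where b = "c * \<delta>"])
      let ?t = "MAX i\<in>{1..m}. norm (x i)"
      have nonneg: "0 \<le> ?t" by (rule MAX_nonneg) simp
      then show "0 \<le> ereal ?t" by simp
      have "?t \<le> c * \<delta> / 2" unfolding MAX_le_iff using x by simp
      also have "\<dots> < c * \<delta>" using c \<delta> by simp
      finally show "ereal ?t < ereal (c * \<delta>)" by simp
      fix s assume s: "ereal ?t < ereal s" "s < c * \<delta>"
      \<comment> \<open>The radius is \<open>\<rho> = s / c\<close>, so that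
        \<open>c * \<rho> = s\<close> bounds all shifts. It is positive even if every shift is
        zero.\<close>
      have "0 < s / c" "s / c < \<delta>" using s nonneg c by (auto simp: field_simps)
      then have "shift_meets \<Omega> xbar (s / c) s" using \<delta>(2)[of "s / c"] c by simp
      moreover have "\<forall>i\<in>{1..m}. norm (x i) \<le> s"
        using s unfolding MAX_le_iff[symmetric] by simp
      ultimately have "(\<Inter>i\<in>{1..m}. \<Omega> i \<ominus>\<^sub>t x i) \<inter> cball xbar (s / c) \<noteq> {}"
        unfolding shift_meets_def by blast
      then show "\<exists>w\<in>\<Inter>i\<in>{1..m}. \<Omega> i \<ominus>\<^sub>t x i. norm (xbar - w) \<le> s / c"
        by (auto simp: dist_norm)
    qed (use c in auto)
    then show "A c" unfolding A_def using c \<delta> by (intro exI[of _ "c * \<delta> / 2"]) auto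
  next
    fix c d :: real assume c: "0 < c" "c < d" and "A d"
    then obtain \<delta> where \<delta>: "0 < \<delta>" "\<And>x :: nat \<Rightarrow> 'a. (\<forall>i\<in>{1..m}. norm (x i) \<le> \<delta>) \<Longrightarrow>
          ereal d * edist_to xbar (\<Inter>i\<in>{1..m}. \<Omega> i \<ominus>\<^sub>t x i) \<le> ereal (MAX i\<in>{1..m}. norm (x i))"
      by (auto simp: A_def)
    \<comment> \<open>The threshold \<open>\<delta> / c\<close> makes shifts of size
      \<open>c * \<rho>\<close> admissible in the metric inequality.\<close>
    have "shift_meets \<Omega> xbar \<rho> (c * \<rho>)" if \<rho>: "0 < \<rho>" "\<rho> < \<delta> / c" for \<rho>
      unfolding shift_meets_def
    proof (intro allI impI)
      fix x :: "nat \<Rightarrow> 'a" assume x: "\<forall>i\<in>{1..m}. norm (x i) \<le> c * \<rho>"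
      have "c * \<rho> \<le> \<delta>" using \<rho> c by (simp add: field_simps)
      then have "ereal d * edist_to xbar (\<Inter>i\<in>{1..m}. \<Omega> i \<ominus>\<^sub>t x i) \<le> ereal (MAX i\<in>{1..m}. norm (x i))"
        using x by (intro \<delta>(2)) force
      also have "\<dots> \<le> ereal (c * \<rho>)" unfolding ereal_less_eq MAX_le_iff by (rule x)
      finally obtain w where "w \<in> (\<Inter>i\<in>{1..m}. \<Omega> i \<ominus>\<^sub>t x i)" "norm (xbar - w) < \<rho>"
        by (rule near_point_of_edist_le[OF _ c \<rho>(1)])
      then have "w \<in> (\<Inter>i\<in>{1..m}. \<Omega> i \<ominus>\<^sub>t x i) \<inter> cball xbar \<rho>" by (simp add: dist_norm)
      then show "(\<Inter>i\<in>{1..m}. \<Omega> i \<ominus>\<^sub>t x i) \<inter> cball xbar \<rho> \<noteq> {}" by blast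
    qed
    then show "C c" unfolding C_def using c \<delta> by (intro exI[of _ "\<delta> / c"]) auto
  qed
qed

section \<open>Subregularity and its constant\<close>

lemma subregularity:
  fixes \<Omega> :: "nat \<Rightarrow> 'a::real_normed_vector set"
  assumes xbar: "xbar \<in> (\<Inter>i\<in>{1..m}. \<Omega> i)"
  defines "A \<equiv> \<lambda>\<gamma>. \<exists>\<delta>>0. \<forall>x\<in>cball xbar \<delta>.
          ereal \<gamma> * edist_to x (\<Inter>i\<in>{1..m}. \<Omega> i) \<le> (MAX i\<in>{1..m}. edist_to x (\<Omega> i))"
  shows "(subregular m \<Omega> xbar \<longleftrightarrow> (\<exists>\<gamma>>0. A \<gamma>)) \<and> zeta m \<Omega> xbar = exact_upper_bound A"
proof -
  define Q where "Q = (\<lambda>\<rho> \<delta> r. (\<Inter>i\<in>{1..m}. \<Omega> i + cball 0 r) \<inter> cball xbar \<delta>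
          \<subseteq> (\<Inter>i\<in>{1..m}. \<Omega> i) + cball 0 \<rho>)"
  define C where "C = (\<lambda>\<alpha>. \<exists>\<delta>>0. \<forall>\<rho>\<in>{0<..<\<delta>}. Q \<rho> \<delta> (\<alpha> * \<rho>))"
  define f where "f = (\<lambda>\<delta>. INF \<rho>\<in>{0<..<\<delta>}. zeta_rho_delta m \<Omega> xbar \<rho> \<delta> / ereal \<rho>)"
  have reg: "subregular m \<Omega> xbar \<longleftrightarrow> (\<exists>\<alpha>>0. C \<alpha>)"
    unfolding subregular_def C_def Q_def ..
  have Q_antimono: "Q \<rho> \<delta> r" if "r \<le> s" "Q \<rho> \<delta> s" for \<rho> \<delta> r s
    using that unfolding Q_def subset_iff Int_iff INT_iff mem_plus_cball_iff by (meson order_trans)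
  have zeta_eq: "zeta_rho_delta m \<Omega> xbar \<rho> \<delta> = (SUP r\<in>{r. 0 \<le> r \<and> Q \<rho> \<delta> r}. ereal r)" for \<rho> \<delta>
    by (simp add: zeta_rho_delta_def Q_def)
  have tendsto: "(f \<longlongrightarrow> zeta m \<Omega> xbar) (at_right 0)"
    unfolding f_def by (rule zeta_tendsto)
  have C_le: "ereal c \<le> zeta m \<Omega> xbar" if "C c" "0 \<le> c" for c
  proof -
    obtain \<delta> where \<delta>: "0 < \<delta>" "\<And>\<rho>. 0 < \<rho> \<Longrightarrow> \<rho> < \<delta> \<Longrightarrow> Q \<rho> \<delta> (c * \<rho>)"
      using \<open>C c\<close> by (auto simp: C_def)
    \<comment> \<open>Shrinking \<open>\<delta>\<close> to \<open>\<delta>'\<close> preserves the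
      inclusion, because only the ball around \<open>xbar\<close> on its left-hand side
      changes.\<close>
    have "ereal c \<le> f \<delta>'" if "0 < \<delta>'" "\<delta>' < \<delta>" for \<delta>'
      unfolding f_def zeta_eq
    proof (rule INF_greatest, rule le_SUP_ereal_divideI)
      fix \<rho> assume \<rho>: "\<rho> \<in> {0<..<\<delta>'}"
      have "cball xbar \<delta>' \<subseteq> cball xbar \<delta>" using that by auto
      then show "Q \<rho> \<delta>' (c * \<rho>)" using \<delta>(2)[of \<rho>] \<rho> that unfolding Q_def by fastforce
    qed (use \<open>0 \<le> c\<close> in auto)
    then have "\<forall>\<^sub>F \<delta>' in at_right 0. ereal c \<le> f \<delta>'"
      using \<delta>(1) by (auto simp: eventually_at_right_field)
    with tendsto show ?thesis by (rule tendsto_lowerbound) simp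
  qed
  show ?thesis
    unfolding reg
  proof (rule eq_exact_upper_bound)
    have "Q \<rho> \<delta> 0" if "0 < \<rho>" for \<rho> \<delta>
    proof -
      have "(\<Inter>i\<in>{1..m}. \<Omega> i) \<subseteq> (\<Inter>i\<in>{1..m}. \<Omega> i) + cball 0 \<rho>"
        unfolding subset_iff mem_plus_cball_iff using that by (metis diff_self less_imp_le norm_zero)
      moreover have "\<Omega> i + cball 0 0 = \<Omega> i" for i
        by (simp add: set_eq_iff mem_plus_cball_iff)
      ultimately show ?thesis unfolding Q_def by auto
    qed
    then have "C 0" unfolding C_def by (auto intro: exI[of _ 1])
    then show "0 \<le> zeta m \<Omega> xbar" using C_le[of 0] by (simp add: zero_ereal_def)
  next
    fix c :: real assume "0 < c" "C c" then show "ereal c \<le> zeta m \<Omega> xbar" by (simp add: C_le)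
  next
    fix c :: real assume "0 < c" and "ereal c < zeta m \<Omega> xbar"
    then have "\<forall>\<^sub>F \<delta> in at_right 0. ereal c < f \<delta>"
      using order_tendstoD(1)[OF tendsto] by blast
    then obtain b where b: "0 < b" "\<And>\<delta>. 0 < \<delta> \<Longrightarrow> \<delta> < b \<Longrightarrow> ereal c < f \<delta>"
      unfolding eventually_at_right_field by auto
    \<comment> \<open>Any value in \<open>]0, b[\<close> serves; one \<open>\<delta>\<close> then
      bounds both \<open>\<rho>\<close> and the ball, as \<open>C\<close> demands.\<close>
    define \<delta> where "\<delta> = b / 2"
    have \<delta>: "0 < \<delta>" "ereal c < f \<delta>" using b by (auto simp: \<delta>_def)
    have "Q \<rho> \<delta> (c * \<rho>)" if "\<rho> \<in> {0<..<\<delta>}" for \<rho>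
    proof (rule less_SUP_ereal_divideD)
      show "ereal c < (SUP r\<in>{r. 0 \<le> r \<and> Q \<rho> \<delta> r}. ereal r) / ereal \<rho>"
        using less_INF_D[OF \<delta>(2)[unfolded f_def zeta_eq] that] .
    qed (use that Q_antimono in auto)
    then show "C c" unfolding C_def using \<delta>(1) by auto
  next
    fix c :: real assume c: "0 < c" and "C c"
    then obtain \<delta> where \<delta>: "0 < \<delta>" "\<And>\<rho>. 0 < \<rho> \<Longrightarrow> \<rho> < \<delta> \<Longrightarrow> Q \<rho> \<delta> (c * \<rho>)"
      by (auto simp: C_def)
    \<comment> \<open>\<open>\<epsilon> \<le> \<delta>\<close> keeps \<open>x\<close> in the ball
      where the inclusion applies. As \<open>xbar\<close> lies in every set,
      \<open>\<epsilon> < c * \<delta>\<close> makes all distances from \<open>x\<close> smaller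
      than \<open>c * \<delta>\<close>.\<close>
    define \<epsilon> where "\<epsilon> = min \<delta> (c * \<delta> / 2)"
    have \<epsilon>: "0 < \<epsilon>" "\<epsilon> \<le> \<delta>" "\<epsilon> < c * \<delta>"
      using \<delta>(1) c by (auto simp: \<epsilon>_def min_less_iff_disj)
    have "ereal c * edist_to x (\<Inter>i\<in>{1..m}. \<Omega> i) \<le> (MAX i\<in>{1..m}. edist_to x (\<Omega> i))"
      if x: "x \<in> cball xbar \<epsilon>" for x
    proof (rule mult_edist_to_le[where b = "c * \<delta>"])
      let ?t = "MAX i\<in>{1..m}. edist_to x (\<Omega> i)"
      show nonneg: "0 \<le> ?t" by (rule MAX_nonneg) (rule edist_to_nonneg)
      have "norm (x - xbar) < c * \<delta>" using x \<epsilon> by (simp add: dist_norm norm_minus_commute)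
      then show "?t < ereal (c * \<delta>)"
        unfolding MAX_less_iff edist_to_less_iff using xbar by blast
      fix s assume s: "?t < ereal s" "s < c * \<delta>"
      have "0 < s" using nonneg s by (metis ereal_less(2) le_less_trans)
      then have "0 < s / c" "s / c < \<delta>" using s c by (auto simp: field_simps)
      then have "Q (s / c) \<delta> s" using \<delta>(2)[of "s / c"] c by simp
      \<comment> \<open>A distance strictly below \<open>s\<close> provides a point within
        \<open>s\<close>, whether or not the distance is attained.\<close>
      moreover have "x \<in> (\<Inter>i\<in>{1..m}. \<Omega> i + cball 0 s)"
        using s(1) unfolding MAX_less_iff edist_to_less_iff INT_iff mem_plus_cball_iff
        by (meson less_imp_le)
      moreover have "x \<in> cball xbar \<delta>" using x \<epsilon> by auto
      ultimately have "x \<in> (\<Inter>i\<in>{1..m}. \<Omega> i) + cball 0 (s / c)" unfolding Q_def by blast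
      then show "\<exists>w\<in>\<Inter>i\<in>{1..m}. \<Omega> i. norm (x - w) \<le> s / c" unfolding mem_plus_cball_iff .
    qed (use c in auto)
    then show "A c" unfolding A_def using \<epsilon>(1) by auto
  next
    fix c d :: real assume c: "0 < c" "c < d" and "A d"
    then obtain \<delta> where \<delta>: "0 < \<delta>" "\<And>x. x \<in> cball xbar \<delta> \<Longrightarrow>
          ereal d * edist_to x (\<Inter>i\<in>{1..m}. \<Omega> i) \<le> (MAX i\<in>{1..m}. edist_to x (\<Omega> i))"
      by (auto simp: A_def)
    \<comment> \<open>The same \<open>\<delta>\<close> works, since the inclusion concerns only
      points of \<open>cball xbar \<delta>\<close>.\<close>
    have "Q \<rho> \<delta> (c * \<rho>)" if \<rho>: "0 < \<rho>" for \<rho>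
      unfolding Q_def
    proof
      fix x assume x: "x \<in> (\<Inter>i\<in>{1..m}. \<Omega> i + cball 0 (c * \<rho>)) \<inter> cball xbar \<delta>"
      then have "ereal d * edist_to x (\<Inter>i\<in>{1..m}. \<Omega> i) \<le> (MAX i\<in>{1..m}. edist_to x (\<Omega> i))"
        using \<delta>(2) by blast
      also have "\<dots> \<le> ereal (c * \<rho>)"
        unfolding MAX_le_iff
      proof
        fix i assume "i \<in> {1..m}"
        then obtain w where "w \<in> \<Omega> i" "norm (x - w) \<le> c * \<rho>"
          using x unfolding Int_iff INT_iff mem_plus_cball_iff by blast
        then show "edist_to x (\<Omega> i) \<le> ereal (c * \<rho>)"
          using edist_to_le by (meson ereal_less_eq(3) order_trans)
      qed
      finally obtain w where "w \<in> (\<Inter>i\<in>{1..m}. \<Omega> i)" "norm (x - w) < \<rho>"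
        by (rule near_point_of_edist_le[OF _ c \<rho>(1)])
      then show "x \<in> (\<Inter>i\<in>{1..m}. \<Omega> i) + cball 0 \<rho>"
        unfolding mem_plus_cball_iff by (meson less_imp_le)
    qed
    then show "C c" unfolding C_def using \<delta>(1) by auto
  qed
qed

section \<open>Neighbourhood bases for the limit in \<open>theta_hat\<close>\<close>

text \<open>The infimum runs over finitely many filters, so an eventual property reduces to one
  condition per coordinate, and the smallest of the finitely many radii is positive.\<close>

lemma eventually_points_to:
  "eventually P (points_to m \<Omega> xbar) \<longleftrightarrow>
    (\<exists>\<delta>>0. \<forall>\<omega>. (\<forall>i\<in>{1..m}. \<omega> i \<in> \<Omega> i \<inter> cball xbar \<delta>) \<longrightarrow> P \<omega>)"
proof
  assume "eventually P (points_to m \<Omega> xbar)"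
  then obtain Q where Q: "\<And>i. i \<in> {1..m} \<Longrightarrow>
        eventually (Q i) (filtercomap (\<lambda>\<omega>. \<omega> i) (inf (nhds xbar) (principal (\<Omega> i))))"
      and QP: "\<And>\<omega>. (\<forall>i\<in>{1..m}. Q i \<omega>) \<Longrightarrow> P \<omega>"
    unfolding points_to_def eventually_INF_finite[OF finite_atLeastAtMost] by blast
  have "\<exists>\<delta>>0. \<forall>\<omega>. \<omega> i \<in> \<Omega> i \<inter> cball xbar \<delta> \<longrightarrow> Q i \<omega>" if i: "i \<in> {1..m}" for i
  proof -
    obtain R e where R: "0 < e" "\<And>z. dist z xbar < e \<Longrightarrow> z \<in> \<Omega> i \<Longrightarrow> R z" "\<And>\<omega>. R (\<omega> i) \<Longrightarrow> Q i \<omega>"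
      using Q[OF i]
      by (auto simp: eventually_filtercomap eventually_inf_principal eventually_nhds_metric)
    show ?thesis
      \<comment> \<open>Halving passes from the open ball of \<open>nhds\<close> to a closed
        ball.\<close>
      by (rule exI[of _ "e / 2"]) (use R in \<open>auto simp: dist_commute\<close>)
  qed
  then obtain e where e: "\<And>i. i \<in> {1..m} \<Longrightarrow> 0 < e i"
    "\<And>i \<omega>. i \<in> {1..m} \<Longrightarrow> \<omega> i \<in> \<Omega> i \<inter> cball xbar (e i) \<Longrightarrow> Q i \<omega>"
    by metis
  define \<delta> where "\<delta> = (MIN i\<in>{1..m}. e i)"
  have "0 < \<delta>" using e(1) m by (simp add: \<delta>_def)
  moreover have "\<delta> \<le> e i" if "i \<in> {1..m}" for i using that by (simp add: \<delta>_def)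
  then have "\<forall>\<omega>. (\<forall>i\<in>{1..m}. \<omega> i \<in> \<Omega> i \<inter> cball xbar \<delta>) \<longrightarrow> P \<omega>"
    by (intro allI impI QP ballI e(2)) force+
  ultimately show "\<exists>\<delta>>0. \<forall>\<omega>. (\<forall>i\<in>{1..m}. \<omega> i \<in> \<Omega> i \<inter> cball xbar \<delta>) \<longrightarrow> P \<omega>" by blast
next
  assume "\<exists>\<delta>>0. \<forall>\<omega>. (\<forall>i\<in>{1..m}. \<omega> i \<in> \<Omega> i \<inter> cball xbar \<delta>) \<longrightarrow> P \<omega>"
  then obtain \<delta> where \<delta>: "0 < \<delta>" "\<And>\<omega>. (\<forall>i\<in>{1..m}. \<omega> i \<in> \<Omega> i \<inter> cball xbar \<delta>) \<Longrightarrow> P \<omega>" by blast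
  have "\<forall>\<^sub>F \<omega> in points_to m \<Omega> xbar. \<omega> i \<in> \<Omega> i \<inter> cball xbar \<delta>" if "i \<in> {1..m}" for i
  proof -
    have "\<forall>\<^sub>F z in inf (nhds xbar) (principal (\<Omega> i)). z \<in> \<Omega> i \<inter> cball xbar \<delta>"
      unfolding eventually_inf_principal eventually_nhds_metric
      using \<delta>(1) by (auto simp: dist_commute intro!: exI[of _ \<delta>])
    then have "\<forall>\<^sub>F \<omega> in filtercomap (\<lambda>\<omega>. \<omega> i) (inf (nhds xbar) (principal (\<Omega> i))).
        \<omega> i \<in> \<Omega> i \<inter> cball xbar \<delta>"
      by (rule eventually_filtercomapI)
    then show ?thesis
      unfolding points_to_def by (rule filter_leD[rotated]) (rule INF_lower[OF that])
  qed
  then have "\<forall>\<^sub>F \<omega> in points_to m \<Omega> xbar. \<forall>i\<in>{1..m}. \<omega> i \<in> \<Omega> i \<inter> cball xbar \<delta>"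
    by (simp add: eventually_ball_finite_distrib)
  then show "eventually P (points_to m \<Omega> xbar)"
    by (rule eventually_mono) (rule \<delta>(2))
qed

text \<open>Turns the product filter into the quantifiers of \<open>uniformly_regular\<close>: the
  smaller of the thresholds for \<open>\<omega>\<close> and \<open>\<rho>\<close> serves
  both.\<close>

lemma eventually_points_to_prod_at_right:
  "(\<forall>\<^sub>F (\<omega>, \<rho>) in points_to m \<Omega> xbar \<times>\<^sub>F at_right 0. P \<omega> \<rho>) \<longleftrightarrow>
    (\<exists>\<delta>>0. \<forall>\<rho>\<in>{0<..<\<delta>::real}. \<forall>\<omega>. (\<forall>i\<in>{1..m}. \<omega> i \<in> \<Omega> i \<inter> cball xbar \<delta>) \<longrightarrow> P \<omega> \<rho>)"
proof
  assume "\<forall>\<^sub>F (\<omega>, \<rho>) in points_to m \<Omega> xbar \<times>\<^sub>F at_right 0. P \<omega> \<rho>"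
  then obtain P1 P2 where P: "eventually P1 (points_to m \<Omega> xbar)" "eventually P2 (at_right (0::real))"
      "\<And>\<omega> \<rho>. P1 \<omega> \<Longrightarrow> P2 \<rho> \<Longrightarrow> P \<omega> \<rho>"
    unfolding eventually_prod_filter by auto
  obtain a where a: "0 < a" "\<And>\<omega>. (\<forall>i\<in>{1..m}. \<omega> i \<in> \<Omega> i \<inter> cball xbar a) \<Longrightarrow> P1 \<omega>"
    using P(1) unfolding eventually_points_to by blast
  obtain b where b: "0 < b" "\<And>\<rho>. 0 < \<rho> \<Longrightarrow> \<rho> < b \<Longrightarrow> P2 \<rho>"
    using P(2) unfolding eventually_at_right_field by auto
  show "\<exists>\<delta>>0. \<forall>\<rho>\<in>{0<..<\<delta>}. \<forall>\<omega>. (\<forall>i\<in>{1..m}. \<omega> i \<in> \<Omega> i \<inter> cball xbar \<delta>) \<longrightarrow> P \<omega> \<rho>"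
  proof (intro exI[of _ "min a b"] conjI ballI allI impI)
    fix \<rho> \<omega> assume "\<rho> \<in> {0<..<min a b}" "\<forall>i\<in>{1..m}. \<omega> i \<in> \<Omega> i \<inter> cball xbar (min a b)"
    then show "P \<omega> \<rho>" by (intro P(3) a(2) b(2)) auto
  qed (use a b in auto)
next
  assume "\<exists>\<delta>>0. \<forall>\<rho>\<in>{0<..<\<delta>}. \<forall>\<omega>. (\<forall>i\<in>{1..m}. \<omega> i \<in> \<Omega> i \<inter> cball xbar \<delta>) \<longrightarrow> P \<omega> \<rho>"
  then obtain \<delta> where \<delta>: "0 < \<delta>" "\<And>\<rho> \<omega>. 0 < \<rho> \<Longrightarrow> \<rho> < \<delta> \<Longrightarrow>
      (\<forall>i\<in>{1..m}. \<omega> i \<in> \<Omega> i \<inter> cball xbar \<delta>) \<Longrightarrow> P \<omega> \<rho>"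
    by auto
  have "\<forall>\<^sub>F \<omega> in points_to m \<Omega> xbar. \<forall>i\<in>{1..m}. \<omega> i \<in> \<Omega> i \<inter> cball xbar \<delta>"
    unfolding eventually_points_to using \<delta>(1) by blast
  moreover have "\<forall>\<^sub>F \<rho> in at_right 0. 0 < \<rho> \<and> \<rho> < \<delta>"
    using \<delta>(1) by (auto simp: eventually_at_right_field)
  ultimately show "\<forall>\<^sub>F (\<omega>, \<rho>) in points_to m \<Omega> xbar \<times>\<^sub>F at_right 0. P \<omega> \<rho>"
    unfolding eventually_prod_filter using \<delta>(2) by (intro exI conjI) auto
qed

section \<open>Uniform regularity and its constant\<close>

text \<open>The two formulations are exchanged by a change of variables: shifts
  \<open>x + y i - \<omega> i\<close> around the points \<open>\<omega> i\<close> in one direction,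
  and \<open>y i = \<omega> i + x i - xbar\<close> at the point \<open>xbar\<close> in the
  other.\<close>

lemma uniform_regularity:
  fixes \<Omega> :: "nat \<Rightarrow> 'a::real_normed_vector set"
  assumes xbar: "xbar \<in> (\<Inter>i\<in>{1..m}. \<Omega> i)"
  defines "A \<equiv> \<lambda>\<gamma>. \<exists>\<delta>>0. \<forall>x\<in>cball xbar \<delta>. \<forall>y :: nat \<Rightarrow> 'a. (\<forall>i\<in>{1..m}. y i \<in> cball 0 \<delta>) \<longrightarrow>
          ereal \<gamma> * edist_to x (\<Inter>i\<in>{1..m}. \<Omega> i \<ominus>\<^sub>t y i) \<le> (MAX i\<in>{1..m}. edist_to (x + y i) (\<Omega> i))"
  shows "(uniformly_regular m \<Omega> xbar \<longleftrightarrow> (\<exists>\<gamma>>0. A \<gamma>)) \<and> theta_hat m \<Omega> xbar = exact_upper_bound A"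
proof -
  let ?F = "points_to m \<Omega> xbar \<times>\<^sub>F at_right (0::real)"
  define C where "C = (\<lambda>\<alpha>. \<exists>\<delta>>0. \<forall>\<rho>\<in>{0<..<\<delta>}. \<forall>\<omega>. (\<forall>i\<in>{1..m}. \<omega> i \<in> \<Omega> i \<inter> cball xbar \<delta>) \<longrightarrow>
      shift_meets (\<lambda>i. \<Omega> i \<ominus>\<^sub>t \<omega> i) 0 \<rho> (\<alpha> * \<rho>))"
  have reg: "uniformly_regular m \<Omega> xbar \<longleftrightarrow> (\<exists>\<alpha>>0. C \<alpha>)"
    unfolding uniformly_regular_def C_def shift_meets_def MAX_le_iff by (simp only: all_simps)
  have C_iff: "C \<alpha> \<longleftrightarrow> (\<forall>\<^sub>F (\<omega>, \<rho>) in ?F. shift_meets (\<lambda>i. \<Omega> i \<ominus>\<^sub>t \<omega> i) 0 \<rho> (\<alpha> * \<rho>))" for \<alpha>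
    unfolding C_def eventually_points_to_prod_at_right ..
  have pos: "\<forall>\<^sub>F (\<omega>, \<rho>) in ?F. 0 < \<rho>"
    unfolding eventually_points_to_prod_at_right by (auto intro: exI[of _ 1])
  have C_le: "ereal c \<le> theta_hat m \<Omega> xbar" if "C c" "0 \<le> c" for c
    unfolding theta_hat_def
    by (rule Liminf_bounded, use that(1)[unfolded C_iff] pos in eventually_elim)
      (use that le_theta_rho_divideI in auto)
  show ?thesis
    unfolding reg
  proof (rule eq_exact_upper_bound)
    have "shift_meets (\<lambda>i. \<Omega> i \<ominus>\<^sub>t \<omega> i) 0 \<rho> 0" if "\<forall>i\<in>{1..m}. \<omega> i \<in> \<Omega> i" "0 < \<rho>" for \<omega> \<rho>
      by (rule shift_meets_0) (use that in \<open>auto simp: mem_translate_back_iff\<close>)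
    then have "C 0" unfolding C_def by (auto intro!: exI[of _ 1])
    then show "0 \<le> theta_hat m \<Omega> xbar" using C_le[of 0] by (simp add: zero_ereal_def)
  next
    fix c :: real assume "0 < c" "C c" then show "ereal c \<le> theta_hat m \<Omega> xbar" by (simp add: C_le)
  next
    fix c :: real assume "ereal c < theta_hat m \<Omega> xbar"
    then have "\<forall>\<^sub>F p in ?F. ereal c <
        (case p of (\<omega>, \<rho>) \<Rightarrow> theta_rho m (\<lambda>i. \<Omega> i \<ominus>\<^sub>t \<omega> i) 0 \<rho> / ereal \<rho>)"
      unfolding theta_hat_def by (rule less_LiminfD)
    then show "C c"
      unfolding C_iff using pos by eventually_elim (auto intro: less_theta_rho_divideD)
  next
    fix c :: real assume c: "0 < c" and "C c"
    then obtain \<delta> where \<delta>: "0 < \<delta>" "\<And>\<rho> \<omega>. 0 < \<rho> \<Longrightarrow> \<rho> < \<delta> \<Longrightarrow>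
        (\<forall>i\<in>{1..m}. \<omega> i \<in> \<Omega> i \<inter> cball xbar \<delta>) \<Longrightarrow> shift_meets (\<lambda>i. \<Omega> i \<ominus>\<^sub>t \<omega> i) 0 \<rho> (c * \<rho>)"
      by (auto simp: C_def)
    \<comment> \<open>Every \<open>x + y i\<close> is within \<open>2 * \<epsilon>\<close> of
      \<open>xbar\<close>, so distances stay below \<open>3 * \<epsilon>\<close>. A nearly closest
      \<open>\<omega> i\<close> is then within \<open>5 * \<epsilon> \<le> \<delta>\<close> of
      \<open>xbar\<close>, and \<open>s < 3 * \<epsilon> \<le> c * \<delta>\<close> gives
      \<open>s / c < \<delta>\<close>.\<close>
    define \<epsilon> where "\<epsilon> = min (\<delta> / 5) (c * \<delta> / 3)"
    have \<epsilon>: "0 < \<epsilon>" "5 * \<epsilon> \<le> \<delta>" "3 * \<epsilon> \<le> c * \<delta>"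
      using \<delta>(1) c by (auto simp: \<epsilon>_def)
    have "ereal c * edist_to x (\<Inter>i\<in>{1..m}. \<Omega> i \<ominus>\<^sub>t y i) \<le> (MAX i\<in>{1..m}. edist_to (x + y i) (\<Omega> i))"
      if x: "x \<in> cball xbar \<epsilon>" and y: "\<forall>i\<in>{1..m}. y i \<in> cball 0 \<epsilon>" for x and y :: "nat \<Rightarrow> 'a"
    proof (rule mult_edist_to_le[where b = "3 * \<epsilon>"])
      let ?t = "MAX i\<in>{1..m}. edist_to (x + y i) (\<Omega> i)"
      show nonneg: "0 \<le> ?t" by (rule MAX_nonneg) (rule edist_to_nonneg)
      have near: "norm (x + y i - xbar) \<le> 2 * \<epsilon>" if "i \<in> {1..m}" for i
        using norm_triangle_ineq[of "x - xbar" "y i"] x y that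
        by (fastforce simp: dist_norm norm_minus_commute algebra_simps)
      show "?t < ereal (3 * \<epsilon>)"
        unfolding MAX_less_iff edist_to_less_iff using xbar near \<epsilon>(1) by force
      fix s assume s: "?t < ereal s" "s < 3 * \<epsilon>"
      have "0 < s" using nonneg s by (metis ereal_less(2) le_less_trans)
      then have "0 < s / c" "s / c < \<delta>" using s c \<epsilon> by (auto simp: field_simps)
      obtain \<omega> where \<omega>: "\<And>i. i \<in> {1..m} \<Longrightarrow> \<omega> i \<in> \<Omega> i \<and> norm (x + y i - \<omega> i) < s"
        using s(1) unfolding MAX_less_iff edist_to_less_iff by metis
      have "dist xbar (\<omega> i) \<le> \<delta>" if "i \<in> {1..m}" for i
      proof -
        have "dist xbar (\<omega> i) \<le> norm (x + y i - xbar) + norm (x + y i - \<omega> i)"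
          by (metis dist_norm dist_triangle dist_commute)
        then show ?thesis using near[OF that] \<omega>[OF that] s(2) \<epsilon> by simp
      qed
      then have "shift_meets (\<lambda>i. \<Omega> i \<ominus>\<^sub>t \<omega> i) 0 (s / c) s"
        using \<delta>(2)[of "s / c" \<omega>] \<open>0 < s / c\<close> \<open>s / c < \<delta>\<close> \<omega> c by simp
      \<comment> \<open>The shifts have norm below \<open>s\<close>, and they cancel
        \<open>\<omega> i\<close>: a common point \<open>z\<close> satisfies
        \<open>x + z + y i \<in> \<Omega> i\<close>.\<close>
      then have "(\<Inter>i\<in>{1..m}. \<Omega> i \<ominus>\<^sub>t \<omega> i \<ominus>\<^sub>t (x + y i - \<omega> i)) \<inter> cball 0 (s / c) \<noteq> {}"
        unfolding shift_meets_def using \<omega> by (meson less_imp_le)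
      then obtain z where z: "\<forall>i\<in>{1..m}. z + (x + y i - \<omega> i) + \<omega> i \<in> \<Omega> i" "norm z \<le> s / c"
        unfolding ex_in_conv[symmetric] Int_iff INT_iff mem_translate_back_iff by auto
      then have "x + z \<in> (\<Inter>i\<in>{1..m}. \<Omega> i \<ominus>\<^sub>t y i)"
        unfolding INT_iff mem_translate_back_iff by (simp add: algebra_simps)
      then show "\<exists>w\<in>\<Inter>i\<in>{1..m}. \<Omega> i \<ominus>\<^sub>t y i. norm (x - w) \<le> s / c"
        by (rule bexI[rotated]) (use z in simp)
    qed (use c in auto)
    then show "A c" unfolding A_def using \<epsilon>(1) by blast
  next
    fix c d :: real assume c: "0 < c" "c < d" and "A d"
    \<comment> \<open>The inequality is instantiated at \<open>x = xbar\<close>; the positions of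
      the \<open>\<omega> i\<close> will be absorbed by the shifts.\<close>
    then obtain \<delta> where \<delta>: "0 < \<delta>" "\<And>y :: nat \<Rightarrow> 'a. (\<forall>i\<in>{1..m}. norm (y i) \<le> \<delta>) \<Longrightarrow>
        ereal d * edist_to xbar (\<Inter>i\<in>{1..m}. \<Omega> i \<ominus>\<^sub>t y i) \<le> (MAX i\<in>{1..m}. edist_to (xbar + y i) (\<Omega> i))"
      by (auto simp: A_def)
    \<comment> \<open>Chosen so that
      \<open>norm (y i) \<le> \<epsilon> + c * \<epsilon> = \<delta>\<close> for the shifts
      \<open>y\<close> below.\<close>
    define \<epsilon> where "\<epsilon> = \<delta> / (1 + c)"
    have "0 < \<epsilon>" "(1 + c) * \<epsilon> = \<delta>" using \<delta>(1) c by (auto simp: \<epsilon>_def)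
    then have \<epsilon>: "0 < \<epsilon>" "\<epsilon> + c * \<epsilon> = \<delta>" by (simp_all add: distrib_right)
    have "shift_meets (\<lambda>i. \<Omega> i \<ominus>\<^sub>t \<omega> i) 0 \<rho> (c * \<rho>)"
      if \<rho>: "0 < \<rho>" "\<rho> < \<epsilon>" and \<omega>: "\<forall>i\<in>{1..m}. \<omega> i \<in> \<Omega> i \<inter> cball xbar \<epsilon>" for \<rho> \<omega>
      unfolding shift_meets_def
    proof (intro allI impI)
      fix x :: "nat \<Rightarrow> 'a" assume x: "\<forall>i\<in>{1..m}. norm (x i) \<le> c * \<rho>"
      \<comment> \<open>Then \<open>xbar + y i - \<omega> i = x i\<close>, so the distance from
        \<open>xbar + y i\<close> to \<open>\<Omega> i\<close> is at most
        \<open>norm (x i)\<close>.\<close>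
      define y where "y = (\<lambda>i. \<omega> i + x i - xbar)"
      have "norm (y i) \<le> \<delta>" if "i \<in> {1..m}" for i
      proof -
        have "norm (y i) \<le> norm (\<omega> i - xbar) + norm (x i)"
          unfolding y_def by (metis add_diff_eq add.commute norm_triangle_ineq)
        moreover have "norm (\<omega> i - xbar) \<le> \<epsilon>"
          using \<omega> that by (simp add: dist_norm norm_minus_commute)
        moreover have "norm (x i) \<le> c * \<rho>" using x that by blast
        moreover have "c * \<rho> \<le> c * \<epsilon>" using c \<rho> by simp
        ultimately show ?thesis using \<epsilon>(2) by linarith
      qed
      then have "ereal d * edist_to xbar (\<Inter>i\<in>{1..m}. \<Omega> i \<ominus>\<^sub>t y i)
          \<le> (MAX i\<in>{1..m}. edist_to (xbar + y i) (\<Omega> i))"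
        by (intro \<delta>(2)) blast
      also have "\<dots> \<le> ereal (c * \<rho>)"
        unfolding MAX_le_iff
      proof
        fix i assume i: "i \<in> {1..m}"
        have "edist_to (xbar + y i) (\<Omega> i) \<le> ereal (norm (xbar + y i - \<omega> i))"
          using \<omega> i by (intro edist_to_le) blast
        also have "\<dots> \<le> ereal (c * \<rho>)" using x i by (simp add: y_def)
        finally show "edist_to (xbar + y i) (\<Omega> i) \<le> ereal (c * \<rho>)" .
      qed
      finally obtain w where w: "w \<in> (\<Inter>i\<in>{1..m}. \<Omega> i \<ominus>\<^sub>t y i)" "norm (xbar - w) < \<rho>"
        by (rule near_point_of_edist_le[OF _ c \<rho>(1)])
      have "w - xbar \<in> (\<Inter>i\<in>{1..m}. \<Omega> i \<ominus>\<^sub>t \<omega> i \<ominus>\<^sub>t x i)"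
        using w(1) unfolding INT_iff mem_translate_back_iff by (simp add: y_def algebra_simps)
      then have "w - xbar \<in> (\<Inter>i\<in>{1..m}. \<Omega> i \<ominus>\<^sub>t \<omega> i \<ominus>\<^sub>t x i) \<inter> cball 0 \<rho>"
        using w(2) by (simp add: norm_minus_commute)
      then show "(\<Inter>i\<in>{1..m}. \<Omega> i \<ominus>\<^sub>t \<omega> i \<ominus>\<^sub>t x i) \<inter> cball 0 \<rho> \<noteq> {}" by blast
    qed
    then show "C c" unfolding C_def using \<epsilon>(1) by auto
  qed
qed

end

theorem theorem3p1:
  fixes m :: nat and \<Omega> :: "nat \<Rightarrow> 'a::real_normed_vector set" and xbar :: 'a
  assumes "m \<ge> 2" and "xbar \<in> (\<Inter>i\<in>{1..m}. \<Omega> i)"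
  shows
   "((semiregular m \<Omega> xbar \<longleftrightarrow>
       (\<exists>\<gamma>>0. \<exists>\<delta>>0. \<forall>x :: nat \<Rightarrow> 'a. (\<forall>i\<in>{1..m}. x i \<in> cball 0 \<delta>) \<longrightarrow>
          ereal \<gamma> * edist_to xbar (\<Inter>i\<in>{1..m}. \<Omega> i \<ominus>\<^sub>t x i) \<le> ereal (MAX i\<in>{1..m}. norm (x i))))
     \<and> theta m \<Omega> xbar = exact_upper_bound (\<lambda>\<gamma>.
         \<exists>\<delta>>0. \<forall>x :: nat \<Rightarrow> 'a. (\<forall>i\<in>{1..m}. x i \<in> cball 0 \<delta>) \<longrightarrow>
          ereal \<gamma> * edist_to xbar (\<Inter>i\<in>{1..m}. \<Omega> i \<ominus>\<^sub>t x i) \<le> ereal (MAX i\<in>{1..m}. norm (x i))))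
    \<and>
    ((subregular m \<Omega> xbar \<longleftrightarrow>
       (\<exists>\<gamma>>0. \<exists>\<delta>>0. \<forall>x\<in>cball xbar \<delta>.
          ereal \<gamma> * edist_to x (\<Inter>i\<in>{1..m}. \<Omega> i) \<le> (MAX i\<in>{1..m}. edist_to x (\<Omega> i))))
     \<and> zeta m \<Omega> xbar = exact_upper_bound (\<lambda>\<gamma>.
         \<exists>\<delta>>0. \<forall>x\<in>cball xbar \<delta>.
          ereal \<gamma> * edist_to x (\<Inter>i\<in>{1..m}. \<Omega> i) \<le> (MAX i\<in>{1..m}. edist_to x (\<Omega> i))))
    \<and>
    ((uniformly_regular m \<Omega> xbar \<longleftrightarrow>
       (\<exists>\<gamma>>0. \<exists>\<delta>>0. \<forall>x\<in>cball xbar \<delta>. \<forall>y :: nat \<Rightarrow> 'a. (\<forall>i\<in>{1..m}. y i \<in> cball 0 \<delta>) \<longrightarrow>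
          ereal \<gamma> * edist_to x (\<Inter>i\<in>{1..m}. \<Omega> i \<ominus>\<^sub>t y i) \<le> (MAX i\<in>{1..m}. edist_to (x + y i) (\<Omega> i))))
     \<and> theta_hat m \<Omega> xbar = exact_upper_bound (\<lambda>\<gamma>.
         \<exists>\<delta>>0. \<forall>x\<in>cball xbar \<delta>. \<forall>y :: nat \<Rightarrow> 'a. (\<forall>i\<in>{1..m}. y i \<in> cball 0 \<delta>) \<longrightarrow>
          ereal \<gamma> * edist_to x (\<Inter>i\<in>{1..m}. \<Omega> i \<ominus>\<^sub>t y i) \<le> (MAX i\<in>{1..m}. edist_to (x + y i) (\<Omega> i))))"
proof -
  have "1 \<le> m" using assms(1) by simp
  then show ?thesis
    using assms(2) by (intro conjI[OF semiregularity conjI[OF subregularity uniform_regularity]])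
qed

end
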